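(* Let $f:\mathbb{R}\to\mathbb{R}$ be a continuously differentiable map and $p$ a fixed point of $f$ with $|f'(p)|\ne1$. Then for all sufficiently small $\delta>0$ and (depending on $\delta$) all sufficiently small $\varepsilon>0$ the following holds: if $g:\mathbb{R}\to\mathbb{R}$ is a locally Lipschitz function with $\|f-g\|_{N_\delta(p)}<\varepsilon$, then there is a unique fixed point $q$ of $g$ in $N_\delta(p)$. Moreover, if $|f'(p)|<1$ then $q$ is a sink of $g$, and if $|f'(p)|>1$ then $q$ is a source of $g$.
   Context: $N_\delta(p)=(p-\delta,p+\delta)$. For a function $u$ that is Lipschitz on $N=N_\delta(p)$, $\|u\|_{N}=\max\{\sup_{x\in \overline{N}}|u(x)|,\ \mathrm{Lip}(u,N)\}$, where $\mathrm{Lip}(u,N)=\sup\{|u(x)-u(y)|/|x-y|:x,y\in N,\ x\neq y\}$. A fixed point $q$ of $g$ is a sink if there is $\epsilon>0$ such that $\lim_{k\to\infty}g^k(x)=q$ for all $x\in N_\epsilon(q)$; it is a source if there is $\epsilon>0$ such that for every $x\in N_\epsilon(q)$, $x\neq q$, there is a positive integer $k$ with $|g^k(x)-q|\ge\epsilon$. *)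

theory Defs
  imports "HOL-Analysis.Analysis"
begin

definition nbhd :: "real \<Rightarrow> real \<Rightarrow> real set"
  where "nbhd \<delta> p = {p - \<delta><..<p + \<delta>}"

(* Both suprema are taken in the extended reals, so they need no boundedness side condition:
   lip_const u N is finite exactly when u is Lipschitz on N. The index set of lip_const is
   nonempty as soon as N has two points, and then the value is nonnegative. *)

definition lip_const :: "(real \<Rightarrow> real) \<Rightarrow> real set \<Rightarrow> ereal"
  where "lip_const u N =
    Sup {ereal (\<bar>u x - u y\<bar> / \<bar>x - y\<bar>) | x y. x \<in> N \<and> y \<in> N \<and> x \<noteq> y}"

definition lip_norm :: "(real \<Rightarrow> real) \<Rightarrow> real set \<Rightarrow> ereal"
  where "lip_norm u N = max (SUP x\<in>closure N. ereal \<bar>u x\<bar>) (lip_const u N)"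

definition locally_lipschitz :: "(real \<Rightarrow> real) \<Rightarrow> bool"
  where "locally_lipschitz g \<longleftrightarrow> (\<forall>x. \<exists>r>0. \<exists>L. L-lipschitz_on (cball x r) g)"

(* The library's local_lipschitz is about families of maps; a single map is a constant family. *)
lemma locally_lipschitz_iff_local_lipschitz:
  "locally_lipschitz g \<longleftrightarrow> local_lipschitz {0::real} UNIV (\<lambda>_. g)"
proof -
  have "{0::real} \<inter> cball 0 u = {0}" if "u > 0" for u
    using that by auto
  then show ?thesis
    unfolding locally_lipschitz_def local_lipschitz_def
    by (simp add: Int_commute) (metis less_imp_le)
qed

definition sink :: "(real \<Rightarrow> real) \<Rightarrow> real \<Rightarrow> bool"
  where "sink g q \<longleftrightarrow> g q = q \<and>
    (\<exists>\<epsilon>>0. \<forall>x\<in>nbhd \<epsilon> q. (\<lambda>k. (g ^^ k) x) \<longlonglongrightarrow> q)"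

definition source :: "(real \<Rightarrow> real) \<Rightarrow> real \<Rightarrow> bool"
  where "source g q \<longleftrightarrow> g q = q \<and>
    (\<exists>\<epsilon>>0. \<forall>x\<in>nbhd \<epsilon> q. x \<noteq> q \<longrightarrow> (\<exists>k>0. \<bar>(g ^^ k) x - q\<bar> \<ge> \<epsilon>))"

end

theory Submission
  imports Defs
begin

text \<open>With \<open>a = f'(p)\<close> and \<open>L = |1 - |a|| / 2\<close>, for small \<open>\<delta>\<close> and \<open>\<epsilon>\<close> the map \<open>g\<close> differs from the
  linear map \<open>x \<mapsto> a x\<close> by an \<open>L\<close>-Lipschitz function on \<open>N\<^sub>\<delta>(p)\<close>. Since \<open>|1 - a| \<ge> 2 L\<close>, the function
  \<open>g x - x\<close> is strictly monotone with slope at least \<open>L\<close> in absolute value and is smaller than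
  \<open>L \<delta> / 2\<close> at \<open>p\<close>, which gives exactly one zero. Around it \<open>g\<close> contracts distances to \<open>q\<close> by the
  factor \<open>|a| + L < 1\<close>, respectively expands them by \<open>|a| - L > 1\<close>.\<close>

lemma mem_nbhd_iff: "x \<in> nbhd \<delta> p \<longleftrightarrow> \<bar>x - p\<bar> < \<delta>"
  by (auto simp: nbhd_def)

lemma lip_norm_less_imp_bound:
  assumes "lip_norm u N < ereal \<epsilon>" "x \<in> N"
  shows "\<bar>u x\<bar> < \<epsilon>"
proof -
  have "x \<in> closure N"
    using assms(2) closure_subset by blast
  then have "ereal \<bar>u x\<bar> \<le> lip_norm u N"
    unfolding lip_norm_def by (intro max.coboundedI1 SUP_upper)
  then show ?thesis
    using assms(1) by (metis ereal_less_eq(3) not_le order.strict_trans2)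
qed

lemma lip_norm_less_imp_lipschitz:
  assumes "lip_norm u N < ereal \<epsilon>" "x \<in> N" "y \<in> N"
  shows "\<bar>u x - u y\<bar> \<le> \<epsilon> * \<bar>x - y\<bar>"
proof (cases "x = y")
  case False
  then have "ereal (\<bar>u x - u y\<bar> / \<bar>x - y\<bar>) \<le> lip_const u N"
    unfolding lip_const_def using assms(2,3) by (intro Sup_upper) blast
  also have "\<dots> \<le> lip_norm u N"
    by (simp add: lip_norm_def)
  finally have "\<bar>u x - u y\<bar> / \<bar>x - y\<bar> \<le> \<epsilon>"
    using assms(1) by (metis ereal_less_eq(3) less_imp_le order.strict_trans1)
  then show ?thesis
    using False by (simp add: divide_le_eq)
qed simp

text \<open>By iteration the distance of the orbit to \<open>q\<close> after \<open>k\<close> steps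
  is at most \<open>c ^ k\<close> times the initial one, which tends to 0.\<close>

lemma sink_if_contracting:
  assumes "g q = q" "\<eta> > 0" "0 \<le> c" "c < 1"
    and contr: "\<And>x. x \<in> nbhd \<eta> q \<Longrightarrow> \<bar>g x - q\<bar> \<le> c * \<bar>x - q\<bar>"
  shows "sink g q"
  unfolding sink_def
proof (intro conjI exI[of _ \<eta>] ballI)
  fix x assume x: "x \<in> nbhd \<eta> q"
  have bound: "\<bar>(g ^^ k) x - q\<bar> \<le> c ^ k * \<bar>x - q\<bar>" for k
  proof (induction k)
    case (Suc k)
    \<comment> \<open>Since \<open>c ^ k\<close> is at most 1, the orbit stays in the neighbourhood,
      so \<open>contr\<close> applies to the next iterate.\<close>
    have "c ^ k * \<bar>x - q\<bar> \<le> 1 * \<bar>x - q\<bar>"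
      using assms(3,4) by (intro mult_right_mono power_le_one) auto
    then have "(g ^^ k) x \<in> nbhd \<eta> q"
      using Suc x by (simp add: mem_nbhd_iff)
    then have "\<bar>g ((g ^^ k) x) - q\<bar> \<le> c * \<bar>(g ^^ k) x - q\<bar>"
      by (rule contr)
    also have "\<dots> \<le> c * (c ^ k * \<bar>x - q\<bar>)"
      using Suc assms(3) by (rule mult_left_mono)
    finally show ?case by (simp add: mult.assoc)
  qed simp
  have "(\<lambda>k. c ^ k * \<bar>x - q\<bar>) \<longlonglongrightarrow> 0"
    using assms(3,4) by (intro tendsto_mult_left_zero LIMSEQ_power_zero) auto
  then have "(\<lambda>k. (g ^^ k) x - q) \<longlonglongrightarrow> 0"
    by (rule Lim_null_comparison[rotated]) (simp add: bound)
  then show "(\<lambda>k. (g ^^ k) x) \<longlonglongrightarrow> q"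
    by (rule LIM_zero_cancel)
qed (use assms in auto)

text \<open>An orbit confined to the neighbourhood would move away from \<open>q\<close> at the
  geometric rate \<open>c ^ k\<close>, hence could not stay bounded; so \<open>\<eta>\<close> itself
  is an escape radius.\<close>

lemma source_if_expanding:
  assumes "g q = q" "\<eta> > 0" "1 < c"
    and expand: "\<And>x. x \<in> nbhd \<eta> q \<Longrightarrow> c * \<bar>x - q\<bar> \<le> \<bar>g x - q\<bar>"
  shows "source g q"
  unfolding source_def
proof (intro conjI exI[of _ \<eta>] ballI impI)
  fix x assume x: "x \<in> nbhd \<eta> q" and "x \<noteq> q"
  show "\<exists>k>0. \<eta> \<le> \<bar>(g ^^ k) x - q\<bar>"
  proof (rule ccontr)
    assume "\<not> ?thesis"
    then have "\<bar>(g ^^ k) x - q\<bar> < \<eta>" if "k > 0" for k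
      using that not_le by blast
    \<comment> \<open>The negated goal covers positive \<open>k\<close> only; for
      \<open>k = 0\<close> the iterate is \<open>x\<close> itself.\<close>
    then have inside: "(g ^^ k) x \<in> nbhd \<eta> q" for k
      using x by (cases "k = 0") (simp_all add: mem_nbhd_iff)
    have bound: "c ^ k * \<bar>x - q\<bar> \<le> \<bar>(g ^^ k) x - q\<bar>" for k
    proof (induction k)
      case (Suc k)
      have "c * (c ^ k * \<bar>x - q\<bar>) \<le> c * \<bar>(g ^^ k) x - q\<bar>"
        using Suc assms(3) by (intro mult_left_mono) auto
      also have "\<dots> \<le> \<bar>g ((g ^^ k) x) - q\<bar>"
        by (rule expand[OF inside])
      finally show ?case by (simp add: mult.assoc)
    qed simp
    obtain k where "\<eta> / \<bar>x - q\<bar> < c ^ k"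
      using real_arch_pow[OF assms(3)] by blast
    then have "\<eta> < c ^ k * \<bar>x - q\<bar>"
      using \<open>x \<noteq> q\<close> by (simp add: divide_less_eq)
    with bound[of k] inside[of k] show False
      by (simp add: mem_nbhd_iff)
  qed
qed (use assms in auto)

text \<open>The difference between \<open>f\<close> and the linear map has derivative
  \<open>D z - D p\<close>, which is small near \<open>p\<close> by continuity of \<open>D\<close>;
  the mean value inequality on the convex neighbourhood turns this into a Lipschitz bound.\<close>

lemma C1_near_linear:
  fixes f :: "real \<Rightarrow> real"
  assumes "f C1_differentiable_on UNIV" "\<kappa> > 0"
  obtains d where "d > 0"
    "\<And>x y. x \<in> nbhd d p \<Longrightarrow> y \<in> nbhd d p \<Longrightarrow>
      \<bar>(f x - deriv f p * x) - (f y - deriv f p * y)\<bar> \<le> \<kappa> * \<bar>x - y\<bar>"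
proof -
  obtain D where D: "\<And>x. (f has_real_derivative D x) (at x)" and "continuous_on UNIV D"
    using assms(1) unfolding C1_differentiable_on_def
    by (auto simp: has_real_derivative_iff_has_vector_derivative)
  then obtain d where d: "d > 0" "\<And>x. \<bar>x - p\<bar> < d \<Longrightarrow> \<bar>D x - D p\<bar> < \<kappa>"
    using assms(2) unfolding continuous_on_iff dist_real_def by blast
  have a: "deriv f p = D p"
    by (rule DERIV_imp_deriv[OF D])
  have "\<bar>(f x - D p * x) - (f y - D p * y)\<bar> \<le> \<kappa> * \<bar>x - y\<bar>"
    if "x \<in> nbhd d p" "y \<in> nbhd d p" for x y
    unfolding real_norm_def[symmetric]
  proof (rule field_differentiable_bound[where S = "nbhd d p" and f' = "\<lambda>z. D z - D p"])
    show "convex (nbhd d p)"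
      by (simp add: nbhd_def)
    show "((\<lambda>z. f z - D p * z) has_field_derivative D z - D p) (at z within nbhd d p)" for z
      by (rule has_field_derivative_at_within) (auto intro!: derivative_eq_intros D)
  qed (use d that in \<open>auto simp: mem_nbhd_iff less_imp_le\<close>)
  with d(1) show thesis
    by (intro that) (simp_all add: a)
qed

text \<open>To be applied to \<open>F x = g x - x\<close> with \<open>b = a - 1\<close>, so that
  zeros of \<open>F\<close> are fixed points of \<open>g\<close>.\<close>

lemma unique_zero_near_linear:
  fixes F :: "real \<Rightarrow> real"
  assumes "\<delta> > 0" "L > 0" "2 * L \<le> \<bar>b\<bar>" "\<bar>F p\<bar> < L * \<delta> / 2"
    and near: "\<And>x y. x \<in> nbhd \<delta> p \<Longrightarrow> y \<in> nbhd \<delta> p \<Longrightarrow>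
      \<bar>(F x - b * x) - (F y - b * y)\<bar> \<le> L * \<bar>x - y\<bar>"
  shows "\<exists>!q. q \<in> nbhd \<delta> p \<and> F q = 0"
proof -
  \<comment> \<open>The sign factor makes the function increasing whatever the sign of
    \<open>b\<close>, and keeps its zeros.\<close>
  define G where "G x = sgn b * F x" for x
  have b: "b \<noteq> 0" using assms by auto
  have zero: "G x = 0 \<longleftrightarrow> F x = 0" for x
    using b by (simp add: G_def sgn_zero_iff)
  have slope: "L * (x - y) \<le> G x - G y"
    if "x \<in> nbhd \<delta> p" "y \<in> nbhd \<delta> p" "y \<le> x" for x y
  proof -
    have "2 * L * (x - y) \<le> \<bar>b\<bar> * (x - y)"
      using assms(3) that(3) by (intro mult_right_mono) auto
    moreover have "\<bar>(F x - b * x) - (F y - b * y)\<bar> \<le> L * (x - y)"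
      using near[OF that(1,2)] that(3) by simp
    ultimately show ?thesis
      using b by (cases "b > 0") (auto simp: G_def algebra_simps)
  qed
  \<comment> \<open>This supplies the continuity for the intermediate value theorem.\<close>
  have "(L + \<bar>b\<bar>)-lipschitz_on (nbhd \<delta> p) F"
  proof (rule lipschitz_onI)
    fix x y assume "x \<in> nbhd \<delta> p" "y \<in> nbhd \<delta> p"
    then have "\<bar>(F x - b * x) - (F y - b * y)\<bar> \<le> L * \<bar>x - y\<bar>"
      by (rule near)
    moreover have "F x - F y = ((F x - b * x) - (F y - b * y)) + b * (x - y)"
      by (simp add: algebra_simps)
    then have "\<bar>F x - F y\<bar> \<le> \<bar>(F x - b * x) - (F y - b * y)\<bar> + \<bar>b\<bar> * \<bar>x - y\<bar>"
      by (metis abs_mult abs_triangle_ineq)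
    ultimately show "dist (F x) (F y) \<le> (L + \<bar>b\<bar>) * dist x y"
      by (simp add: dist_real_def distrib_right)
  qed (use assms in auto)
  then have "continuous_on (nbhd \<delta> p) G"
    unfolding G_def by (intro continuous_intros lipschitz_on_continuous_on)
  then have cont: "continuous_on {p - \<delta> / 2..p + \<delta> / 2} G"
    by (rule continuous_on_subset) (use assms(1) in \<open>auto simp: nbhd_def\<close>)
  have Gp: "\<bar>G p\<bar> < L * \<delta> / 2"
    using assms(4) b by (simp add: G_def abs_mult abs_sgn_eq)
  \<comment> \<open>Over a distance \<open>\<delta> / 2\<close> on either side of \<open>p\<close>,
    \<open>G\<close> changes by at least \<open>L * \<delta> / 2\<close>, which exceeds
    \<open>\<bar>G p\<bar>\<close>; half the radius keeps the endpoints inside the open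
    neighbourhood.\<close>
  have "G (p - \<delta> / 2) \<le> 0" "0 \<le> G (p + \<delta> / 2)"
    using slope[of p "p - \<delta> / 2"] slope[of "p + \<delta> / 2" p] Gp assms(1)
    by (auto simp: mem_nbhd_iff)
  then obtain q where "p - \<delta> / 2 \<le> q" "q \<le> p + \<delta> / 2" "G q = 0"
    using IVT'[of G "p - \<delta> / 2" 0 "p + \<delta> / 2"] cont assms(1) by auto
  then have "q \<in> nbhd \<delta> p \<and> F q = 0"
    using assms(1) by (auto simp: nbhd_def zero)
  moreover have "x = y" if "x \<in> nbhd \<delta> p" "y \<in> nbhd \<delta> p" "G x = 0" "G y = 0" for x y
  proof -
    have "x = y" if "x \<in> nbhd \<delta> p" "y \<in> nbhd \<delta> p" "G x = 0" "G y = 0" "y \<le> x" for x y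
      using slope[OF that(1,2,5)] that assms(2) by (simp add: mult_le_0_iff)
    then show ?thesis
      using that linear[of x y] by metis
  qed
  ultimately show ?thesis
    unfolding zero by blast
qed

text \<open>Taking \<open>y = q\<close> in \<open>near\<close> compares \<open>g x - q\<close> with
  \<open>a * (x - q)\<close>; the triangle inequality then bounds \<open>\<bar>g x - q\<bar>\<close>
  from both sides.\<close>

lemma fixed_point_sink_or_source_near_linear:
  fixes g :: "real \<Rightarrow> real"
  assumes "q \<in> nbhd \<delta> p" "g q = q" "L > 0"
    and near: "\<And>x y. x \<in> nbhd \<delta> p \<Longrightarrow> y \<in> nbhd \<delta> p \<Longrightarrow>
      \<bar>(g x - a * x) - (g y - a * y)\<bar> \<le> L * \<bar>x - y\<bar>"
  shows "\<bar>a\<bar> + L < 1 \<Longrightarrow> sink g q" and "\<bar>a\<bar> - L > 1 \<Longrightarrow> source g q"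
proof -
  \<comment> \<open>The distance from \<open>q\<close> to the nearer endpoint, so that
    \<open>nbhd \<eta> q\<close> lies inside \<open>nbhd \<delta> p\<close>.\<close>
  define \<eta> where "\<eta> = \<delta> - \<bar>q - p\<bar>"
  have \<eta>: "\<eta> > 0"
    using assms(1) by (simp add: \<eta>_def mem_nbhd_iff)
  have dev: "\<bar>(g x - q) - a * (x - q)\<bar> \<le> L * \<bar>x - q\<bar>" if "x \<in> nbhd \<eta> q" for x
    using near[of x q] that assms(1,2) by (auto simp: \<eta>_def mem_nbhd_iff algebra_simps)
  have le: "\<bar>g x - q\<bar> \<le> (\<bar>a\<bar> + L) * \<bar>x - q\<bar>"
    and ge: "(\<bar>a\<bar> - L) * \<bar>x - q\<bar> \<le> \<bar>g x - q\<bar>" if "x \<in> nbhd \<eta> q" for x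
    using dev[OF that] abs_mult[of a "x - q"] by (simp_all add: distrib_right left_diff_distrib)
  show "sink g q" if "\<bar>a\<bar> + L < 1"
    using assms(2,3) \<eta> that le by (intro sink_if_contracting[where \<eta> = \<eta> and c = "\<bar>a\<bar> + L"]) auto
  show "source g q" if "\<bar>a\<bar> - L > 1"
    using assms(2) \<eta> that ge by (intro source_if_expanding[where \<eta> = \<eta> and c = "\<bar>a\<bar> - L"]) auto
qed

theorem theorem5p3:
  fixes f :: "real \<Rightarrow> real" and p :: real
  assumes "f C1_differentiable_on UNIV"
    and "f p = p"
    and "\<bar>deriv f p\<bar> \<noteq> 1"
  shows "\<exists>\<delta>0>0. \<forall>\<delta>. 0 < \<delta> \<and> \<delta> < \<delta>0 \<longrightarrow>
    (\<exists>\<epsilon>0>0. \<forall>\<epsilon>. 0 < \<epsilon> \<and> \<epsilon> < \<epsilon>0 \<longrightarrow>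
      (\<forall>g. locally_lipschitz g \<and> lip_norm (\<lambda>x. f x - g x) (nbhd \<delta> p) < ereal \<epsilon> \<longrightarrow>
        (\<exists>!q. q \<in> nbhd \<delta> p \<and> g q = q) \<and>
        (\<forall>q. q \<in> nbhd \<delta> p \<and> g q = q \<longrightarrow>
          (\<bar>deriv f p\<bar> < 1 \<longrightarrow> sink g q) \<and>
          (\<bar>deriv f p\<bar> > 1 \<longrightarrow> source g q))))"
proof -
  define a where "a = deriv f p"
  \<comment> \<open>Half the gap between \<open>\<bar>a\<bar>\<close> and 1; the reverse triangle
    inequality gives \<open>2 * L \<le> \<bar>a - 1\<bar>\<close>.\<close>
  define L where "L = \<bar>1 - \<bar>a\<bar>\<bar> / 2"
  have L: "L > 0" "2 * L \<le> \<bar>a - 1\<bar>"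
    using assms(3) by (auto simp: L_def a_def)
  \<comment> \<open>Half of the allowance \<open>L\<close> goes to \<open>f\<close>; the other half
    is kept for the perturbation \<open>f - g\<close>.\<close>
  obtain d where d: "d > 0" and f_near: "\<And>x y. x \<in> nbhd d p \<Longrightarrow> y \<in> nbhd d p \<Longrightarrow>
      \<bar>(f x - a * x) - (f y - a * y)\<bar> \<le> L / 2 * \<bar>x - y\<bar>"
    unfolding a_def using C1_near_linear[OF assms(1), of "L / 2" p] L(1) by auto
  have main: "(\<exists>!q. q \<in> nbhd \<delta> p \<and> g q = q) \<and>
      (\<forall>q. q \<in> nbhd \<delta> p \<and> g q = q \<longrightarrow>
        (\<bar>a\<bar> < 1 \<longrightarrow> sink g q) \<and> (\<bar>a\<bar> > 1 \<longrightarrow> source g q))"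
    if \<delta>: "0 < \<delta>" "\<delta> < d" and \<epsilon>: "\<epsilon> < L / 2" "\<epsilon> < L * \<delta> / 2"
      and norm: "lip_norm (\<lambda>x. f x - g x) (nbhd \<delta> p) < ereal \<epsilon>" for \<delta> \<epsilon> g
  proof (rule conjI)
    have near: "\<bar>(g x - a * x) - (g y - a * y)\<bar> \<le> L * \<bar>x - y\<bar>"
      if "x \<in> nbhd \<delta> p" "y \<in> nbhd \<delta> p" for x y
    proof -
      have "\<bar>(f x - a * x) - (f y - a * y)\<bar> \<le> L / 2 * \<bar>x - y\<bar>"
        using that \<delta>(2) by (intro f_near) (auto simp: mem_nbhd_iff)
      moreover have "\<bar>(f x - g x) - (f y - g y)\<bar> \<le> \<epsilon> * \<bar>x - y\<bar>"
        by (rule lip_norm_less_imp_lipschitz[OF norm that])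
      moreover have "\<epsilon> * \<bar>x - y\<bar> \<le> L / 2 * \<bar>x - y\<bar>"
        using \<epsilon>(1) by (intro mult_right_mono) auto
      ultimately show ?thesis by linarith
    qed
    have "\<bar>f p - g p\<bar> < \<epsilon>"
      by (rule lip_norm_less_imp_bound[OF norm]) (simp add: mem_nbhd_iff \<delta>)
    then have "\<bar>g p - p\<bar> < L * \<delta> / 2"
      using assms(2) \<epsilon>(2) by linarith
    \<comment> \<open>Subtracting the identity from both \<open>g\<close> and the linear map leaves
      their difference unchanged.\<close>
    moreover have "\<bar>(g x - x - (a - 1) * x) - (g y - y - (a - 1) * y)\<bar> \<le> L * \<bar>x - y\<bar>"
      if "x \<in> nbhd \<delta> p" "y \<in> nbhd \<delta> p" for x y
      using near[OF that] by (simp add: left_diff_distrib)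
    ultimately have "\<exists>!q. q \<in> nbhd \<delta> p \<and> g q - q = 0"
      using \<delta>(1) L by (intro unique_zero_near_linear[where F = "\<lambda>x. g x - x"]) auto
    then show "\<exists>!q. q \<in> nbhd \<delta> p \<and> g q = q"
      by simp
    show "\<forall>q. q \<in> nbhd \<delta> p \<and> g q = q \<longrightarrow>
        (\<bar>a\<bar> < 1 \<longrightarrow> sink g q) \<and> (\<bar>a\<bar> > 1 \<longrightarrow> source g q)"
    proof (intro allI impI conjI; elim conjE)
      fix q assume q: "q \<in> nbhd \<delta> p" "g q = q"
      \<comment> \<open>In both cases the resulting factor, \<open>\<bar>a\<bar> + L\<close> or
        \<open>\<bar>a\<bar> - L\<close>, is the midpoint of \<open>\<bar>a\<bar>\<close> and 1,
        hence on the same side of 1 as \<open>\<bar>a\<bar>\<close>.\<close>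
      note fixed = fixed_point_sink_or_source_near_linear[OF q L(1) near]
      show "sink g q" if "\<bar>a\<bar> < 1"
      proof (rule fixed(1))
        have "2 * L = 1 - \<bar>a\<bar>"
          using that by (simp add: L_def)
        then show "\<bar>a\<bar> + L < 1"
          using that by linarith
      qed
      show "source g q" if "\<bar>a\<bar> > 1"
      proof (rule fixed(2))
        have "2 * L = \<bar>a\<bar> - 1"
          using that by (simp add: L_def)
        then show "1 < \<bar>a\<bar> - L"
          using that by linarith
      qed
    qed
  qed
  show ?thesis
    unfolding a_def[symmetric]
  proof (rule exI[of _ d], rule conjI[OF d allI[OF impI]])
    fix \<delta> assume "0 < \<delta> \<and> \<delta> < d"
    then have \<delta>: "0 < \<delta>" "\<delta> < d"
      by auto
    show "\<exists>\<epsilon>0>0. \<forall>\<epsilon>. 0 < \<epsilon> \<and> \<epsilon> < \<epsilon>0 \<longrightarrow>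
      (\<forall>g. locally_lipschitz g \<and> lip_norm (\<lambda>x. f x - g x) (nbhd \<delta> p) < ereal \<epsilon> \<longrightarrow>
        (\<exists>!q. q \<in> nbhd \<delta> p \<and> g q = q) \<and>
        (\<forall>q. q \<in> nbhd \<delta> p \<and> g q = q \<longrightarrow>
          (\<bar>a\<bar> < 1 \<longrightarrow> sink g q) \<and> (\<bar>a\<bar> > 1 \<longrightarrow> source g q)))"
    \<comment> \<open>The first bound controls the Lipschitz constant of \<open>f - g\<close>, the
      second its value at \<open>p\<close>; the second is where the threshold depends on
      \<open>\<delta>\<close>.\<close>
    proof (rule exI[of _ "min (L / 2) (L * \<delta> / 2)"],
        rule conjI[OF _ allI[OF impI[OF allI[OF impI]]]])
      show "0 < min (L / 2) (L * \<delta> / 2)"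
        using L(1) \<delta>(1) by simp
    next
      fix \<epsilon> g
      assume "0 < \<epsilon> \<and> \<epsilon> < min (L / 2) (L * \<delta> / 2)"
        and "locally_lipschitz g \<and> lip_norm (\<lambda>x. f x - g x) (nbhd \<delta> p) < ereal \<epsilon>"
      then have "\<epsilon> < L / 2" "\<epsilon> < L * \<delta> / 2"
        and "lip_norm (\<lambda>x. f x - g x) (nbhd \<delta> p) < ereal \<epsilon>"
        by (simp_all only: min_less_iff_conj)
      then show "(\<exists>!q. q \<in> nbhd \<delta> p \<and> g q = q) \<and>
        (\<forall>q. q \<in> nbhd \<delta> p \<and> g q = q \<longrightarrow>
          (\<bar>a\<bar> < 1 \<longrightarrow> sink g q) \<and> (\<bar>a\<bar> > 1 \<longrightarrow> source g q))"
        by (rule main[OF \<delta>])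
    qed
  qed
qed

end
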